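(* Let $X$ be a Banach space over $\mathbb{R}$ or $\mathbb{C}$, and let $X_1\subset X_2\subset\cdots\subset X$ be closed subspaces with $X=\overline{\bigcup_{m=1}^{\infty}X_m}$. Suppose that for every $m\in\mathbb{N}$ there is a continuous linear projection $P_m$ from $X_{m+1}$ onto $X_m$ with $\|P_m\|=1$, and that the norm of $X$ satisfies the Local Characterization Condition (LCC) with respect to $(X_m)$ and $(P_m)$. Then for every $m\in\mathbb{N}$, $$n(X_m)\ge n(X).$$
   Context: For a Banach space $Z$, $S_Z$ denotes its unit sphere, $Z^*$ its dual, and $\mathcal{L}(Z)$ the space of bounded linear operators on $Z$ with the operator norm. Numerical radius and index. For $T\in\mathcal{L}(Z)$, $\nu(T)=\sup\{|x^*(Tx)| : x\in S_Z,\ x^*\in S_{Z^*},\ x^*(x)=1\}$, and $n(Z)=\inf\{\nu(T): T\in\mathcal{L}(Z),\ \|T\|=1\}$. Norming functional. A norming functional for a nonzero $z\in Z$ is an $f\in Z^*$ with $\|f\|=1$ and $f(z)=\|z\|$. Local Characterization Condition (LCC). For every $m\in\mathbb{N}$, every $x\in X_{m+1}$ with $\|x\|=1$ and $P_mx\neq 0$, and every norming functional $x^*\in S_{X_{m+1}^*}$ for $x$, there exists a constant $b_m(x)\in\mathbb{R}$ such that $b_m(x)\,x^*|_{X_m}$ is a norming functional for $P_mx$ in $X_m^*$. *)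

theory Defs
  imports "HOL-Analysis.Analysis"
begin

text \<open>
  The scalar field is \<open>\<real>\<close> or \<open>\<complex>\<close> with its usual absolute value, up to isometric isomorphism.
  The axiom is a disjunction, so both \<^typ>\<open>real\<close> and \<^typ>\<open>complex\<close> are instances and a theorem
  about this class covers both cases at once.
\<close>

class real_or_complex_field = real_normed_field +
  assumes real_or_complex:
    "(\<exists>\<phi> :: 'a \<Rightarrow> real. bij \<phi> \<and> (\<forall>x y. \<phi> (x + y) = \<phi> x + \<phi> y) \<and>
        (\<forall>x y. \<phi> (x * y) = \<phi> x * \<phi> y) \<and> (\<forall>x. norm (\<phi> x) = norm x)) \<or>
     (\<exists>\<phi> :: 'a \<Rightarrow> complex. bij \<phi> \<and> (\<forall>x y. \<phi> (x + y) = \<phi> x + \<phi> y) \<and>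
        (\<forall>x y. \<phi> (x * y) = \<phi> x * \<phi> y) \<and> (\<forall>x. norm (\<phi> x) = norm x))"

instance real :: real_or_complex_field
proof
qed (rule disjI1, rule exI[of _ id], simp)

instance complex :: real_or_complex_field
proof
qed (rule disjI2, rule exI[of _ id], simp)

text \<open>
  The library has normed spaces over \<open>\<real>\<close> only.  A normed space over \<open>'k\<close> is a real normed space
  together with a scalar multiplication by \<open>'k\<close> that extends the real one and for which the norm
  is homogeneous.  Completeness is a property of the norm alone, so a Banach space over \<open>'k\<close> is
  such a structure on a type of class \<^class>\<open>banach\<close>.
\<close>

locale normed_space_over = vector_space scale
  for scale :: "'k::real_or_complex_field \<Rightarrow> 'a::real_normed_vector \<Rightarrow> 'a" +
  assumes scale_of_real: "scale (of_real r) x = r *\<^sub>R x"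
    and norm_scale: "norm (scale c x) = norm c * norm x"

lemma normed_space_over_scaleR:
  "normed_space_over (scaleR :: real \<Rightarrow> 'a::real_normed_vector \<Rightarrow> 'a)"
  by unfold_locales (simp_all add: algebra_simps)

lemma normed_space_over_mult:
  "normed_space_over ((*) :: 'k::real_or_complex_field \<Rightarrow> 'k \<Rightarrow> 'k)"
  by unfold_locales (simp_all add: algebra_simps norm_mult scaleR_conv_of_real)

text \<open>
  Subspaces are sets in the ambient type, and a map defined on a subspace \<open>Z\<close> is a function on the
  ambient type of which only the values on \<open>Z\<close> matter.
\<close>

definition bounded_linear_on ::
  "('k::real_or_complex_field \<Rightarrow> 'a::real_normed_vector \<Rightarrow> 'a) \<Rightarrow>
   ('k \<Rightarrow> 'b::real_normed_vector \<Rightarrow> 'b) \<Rightarrow> 'a set \<Rightarrow> ('a \<Rightarrow> 'b) \<Rightarrow> bool" where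
  "bounded_linear_on s1 s2 Z f \<longleftrightarrow>
     (\<forall>x\<in>Z. \<forall>y\<in>Z. f (x + y) = f x + f y) \<and>
     (\<forall>c. \<forall>x\<in>Z. f (s1 c x) = s2 c (f x)) \<and>
     (\<exists>K. \<forall>x\<in>Z. norm (f x) \<le> K * norm x)"

definition onorm_on :: "'a::real_normed_vector set \<Rightarrow> ('a \<Rightarrow> 'b::real_normed_vector) \<Rightarrow> real" where
  "onorm_on Z f = (SUP x \<in> {x \<in> Z. norm x \<le> 1}. norm (f x))"

definition operators_on ::
  "('k::real_or_complex_field \<Rightarrow> 'a::real_normed_vector \<Rightarrow> 'a) \<Rightarrow> 'a set \<Rightarrow> ('a \<Rightarrow> 'a) set" where
  "operators_on s Z = {T. T ` Z \<subseteq> Z \<and> bounded_linear_on s s Z T}"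

definition dual_on ::
  "('k::real_or_complex_field \<Rightarrow> 'a::real_normed_vector \<Rightarrow> 'a) \<Rightarrow> 'a set \<Rightarrow> ('a \<Rightarrow> 'k) set" where
  "dual_on s Z = {f. bounded_linear_on s (*) Z f}"

text \<open>
  On a subspace \<open>Z \<noteq> {0}\<close> the sets below are nonempty and bounded, so the real-valued supremum and
  infimum are the intended ones.
\<close>

definition numerical_radius ::
  "('k::real_or_complex_field \<Rightarrow> 'a::real_normed_vector \<Rightarrow> 'a) \<Rightarrow> 'a set \<Rightarrow> ('a \<Rightarrow> 'a) \<Rightarrow> real" where
  "numerical_radius s Z T =
     Sup {norm (f (T x)) | x f. x \<in> Z \<and> norm x = 1 \<and>
            f \<in> dual_on s Z \<and> onorm_on Z f = 1 \<and> f x = 1}"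

definition numerical_index ::
  "('k::real_or_complex_field \<Rightarrow> 'a::real_normed_vector \<Rightarrow> 'a) \<Rightarrow> 'a set \<Rightarrow> real" where
  "numerical_index s Z =
     Inf {numerical_radius s Z T | T. T \<in> operators_on s Z \<and> onorm_on Z T = 1}"

definition norming_functional ::
  "('k::real_or_complex_field \<Rightarrow> 'a::real_normed_vector \<Rightarrow> 'a) \<Rightarrow> 'a set \<Rightarrow> 'a \<Rightarrow> ('a \<Rightarrow> 'k) \<Rightarrow> bool"
where
  "norming_functional s Z z f \<longleftrightarrow>
     z \<in> Z \<and> z \<noteq> 0 \<and> f \<in> dual_on s Z \<and> onorm_on Z f = 1 \<and> f z = of_real (norm z)"

text \<open>
  The constant \<open>b\<close> is chosen after the functional \<open>f\<close>, so it may depend on \<open>f\<close> as well as on \<open>x\<close>.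
\<close>

definition local_characterization_condition ::
  "('k::real_or_complex_field \<Rightarrow> 'a::real_normed_vector \<Rightarrow> 'a) \<Rightarrow>
   (nat \<Rightarrow> 'a set) \<Rightarrow> (nat \<Rightarrow> 'a \<Rightarrow> 'a) \<Rightarrow> bool" where
  "local_characterization_condition s X P \<longleftrightarrow>
     (\<forall>m. \<forall>x \<in> X (Suc m). norm x = 1 \<longrightarrow> P m x \<noteq> 0 \<longrightarrow>
        (\<forall>f. norming_functional s (X (Suc m)) x f \<longrightarrow>
           (\<exists>b::real. norming_functional s (X m) (P m x) (\<lambda>y. of_real b * f y))))"

definition projection_onto ::
  "('k::real_or_complex_field \<Rightarrow> 'a::real_normed_vector \<Rightarrow> 'a) \<Rightarrow> 'a set \<Rightarrow> 'a set \<Rightarrow> ('a \<Rightarrow> 'a) \<Rightarrow> bool"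
where
  "projection_onto s Z Y P \<longleftrightarrow>
     bounded_linear_on s s Z P \<and> P ` Z = Y \<and> (\<forall>x\<in>Z. P (P x) = P x)"

end

theory Submission imports Defs begin

text \<open>
  An operator \<open>T\<close> on \<open>X\<^sub>m\<close> of norm one is composed with the projections and extended by density
  to an operator \<open>S\<close> on \<open>X\<close> of norm one.  By the LCC, a functional \<open>f\<close> norming a unit vector \<open>x\<close> of
  \<open>X\<^bsub>m+k+1\<^esub>\<close> is, up to a factor \<open>b\<close> with \<open>\<bar>b\<bar> \<ge> 1\<close>, norming for the image of \<open>x\<close> in \<open>X\<^bsub>m+k\<^esub>\<close>, so
  inductively \<open>\<bar>f (S x)\<bar> \<le> \<nu>(T)\<close> on every \<open>X\<^bsub>m+k\<^esub>\<close>.  To reach the limit, this is rewritten as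
  \<open>\<parallel>y - a S y\<parallel> \<ge> (1 - \<bar>a\<bar> \<nu>(T)) \<parallel>y\<parallel>\<close>, which extends to all \<open>y\<close> in \<open>X\<close>.  As in Lumer's argument,
  inserting \<open>y = x + a S x\<close> with \<open>a f(S x) = \<alpha> \<bar>f(S x)\<bar>\<close> and \<open>\<bar>a\<bar> = \<alpha>\<close> gives
  \<open>(1 - \<alpha> \<nu>(T)) (1 + \<alpha> \<bar>f(S x)\<bar>) \<le> 1 + \<alpha>\<^sup>2\<close>, and \<open>\<alpha> \<rightarrow> 0\<close> yields \<open>\<bar>f(S x)\<bar> \<le> \<nu>(T)\<close>.
\<close>

section \<open>Minimal sublinear functionals\<close>

text \<open>Homogeneity is only required as an inequality, which is all that has to be checked for
  tilts and infima of chains. Applying it to \<open>inverse r\<close> as well gives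
  equality.\<close>

definition sublinear :: "('a::real_vector \<Rightarrow> real) \<Rightarrow> bool" where
  "sublinear q \<longleftrightarrow> (\<forall>x y. q (x + y) \<le> q x + q y) \<and> (\<forall>r>0. \<forall>x. q (r *\<^sub>R x) \<le> r * q x)"

lemma sublinearI:
  assumes "\<And>x y. q (x + y) \<le> q x + q y" and "\<And>r x. r > 0 \<Longrightarrow> q (r *\<^sub>R x) \<le> r * q x"
  shows "sublinear q"
  using assms by (simp add: sublinear_def)

lemma sublinear_add: "sublinear q \<Longrightarrow> q (x + y) \<le> q x + q y"
  by (simp add: sublinear_def)

lemma sublinear_zero:
  assumes "sublinear q" shows "q 0 = 0"
proof -
  \<comment> \<open>The factor 2 forces \<open>q 0\<close> to be nonnegative, the factor 1/2 forces
    it to be nonpositive.\<close>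
  have "q (2 *\<^sub>R 0) \<le> 2 * q 0" "q ((1/2) *\<^sub>R 0) \<le> (1/2) * q 0"
    using assms unfolding sublinear_def by (meson zero_less_numeral half_gt_zero_iff zero_less_one)+
  then show ?thesis by simp
qed

lemma sublinear_scale:
  assumes "sublinear q" "r \<ge> 0" shows "q (r *\<^sub>R x) = r * q x"
proof (cases "r = 0")
  case True
  then show ?thesis by (simp add: sublinear_zero assms)
next
  case False
  then have r: "r > 0" using assms by simp
  then have "q (inverse r *\<^sub>R (r *\<^sub>R x)) \<le> inverse r * q (r *\<^sub>R x)"
    using assms(1) unfolding sublinear_def by (meson positive_imp_inverse_positive)
  then have "r * q x \<le> q (r *\<^sub>R x)"
    using r by (simp add: field_simps)
  moreover have "q (r *\<^sub>R x) \<le> r * q x"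
    using assms(1) r by (simp add: sublinear_def)
  ultimately show ?thesis by simp
qed

lemma sublinear_minus:
  assumes "sublinear q" shows "- q (- x) \<le> q x"
  using sublinear_add[OF assms, of x "- x"] sublinear_zero[OF assms] by simp

lemma sublinear_norm: "sublinear norm"
  by (rule sublinearI) (simp_all add: norm_triangle_ineq)

text \<open>
  Norming functionals come from Zorn's lemma without extending from subspaces: a minimal sublinear
  functional equals its own tilt in every direction, and this forces additivity.
\<close>

definition tilt :: "'a::real_vector \<Rightarrow> ('a \<Rightarrow> real) \<Rightarrow> 'a \<Rightarrow> real" where
  "tilt y q x = (INF t\<in>{0..}. q (x + t *\<^sub>R y) - t * q y)"

text \<open>A real infimum is meaningful only if the values are bounded below; the bound
  \<open>- q (- x)\<close> does not depend on \<open>t\<close>.\<close>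

lemma tilt_bdd_below:
  assumes "sublinear q"
  shows "bdd_below ((\<lambda>t. q (x + t *\<^sub>R y) - t * q y) ` {0..})"
proof (rule bdd_belowI2)
  fix t :: real assume "t \<in> {0..}"
  then have "t * q y = q ((x + t *\<^sub>R y) + (- x))"
    using sublinear_scale[OF assms, of t y] by simp
  also have "\<dots> \<le> q (x + t *\<^sub>R y) + q (- x)"
    by (rule sublinear_add[OF assms])
  finally show "- q (- x) \<le> q (x + t *\<^sub>R y) - t * q y" by simp
qed

lemma tilt_le:
  assumes "sublinear q" "t \<ge> 0"
  shows "tilt y q x \<le> q (x + t *\<^sub>R y) - t * q y"
  unfolding tilt_def using assms by (intro cINF_lower tilt_bdd_below) auto

lemma tilt_greatest:
  assumes "\<And>t. t \<ge> 0 \<Longrightarrow> m \<le> q (x + t *\<^sub>R y) - t * q y"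
  shows "m \<le> tilt y q x"
  unfolding tilt_def using assms by (intro cINF_greatest) auto

text \<open>Parameters \<open>a\<close> for \<open>u\<close> and \<open>b\<close> for
  \<open>v\<close> combine to the competitor \<open>a + b\<close> for \<open>u + v\<close>, and the
  two infima are then taken one after the other. For homogeneity the parameter \<open>t\<close> is
  rescaled to \<open>r * t\<close>.\<close>

lemma sublinear_tilt:
  assumes q: "sublinear q" shows "sublinear (tilt y q)"
proof (rule sublinearI)
  fix u v
  have "tilt y q (u + v) - (q (u + a *\<^sub>R y) - a * q y) \<le> q (v + b *\<^sub>R y) - b * q y"
    if "a \<ge> 0" "b \<ge> 0" for a b
  proof -
    have "tilt y q (u + v) \<le> q ((u + v) + (a + b) *\<^sub>R y) - (a + b) * q y"
      using that by (intro tilt_le q) auto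
    moreover have "q ((u + v) + (a + b) *\<^sub>R y) \<le> q (u + a *\<^sub>R y) + q (v + b *\<^sub>R y)"
      using sublinear_add[OF q, of "u + a *\<^sub>R y" "v + b *\<^sub>R y"]
      by (simp add: algebra_simps)
    ultimately show ?thesis by (simp add: algebra_simps)
  qed
  then have "tilt y q (u + v) - (q (u + a *\<^sub>R y) - a * q y) \<le> tilt y q v" if "a \<ge> 0" for a
    using that by (intro tilt_greatest) auto
  then have "tilt y q (u + v) - tilt y q v \<le> tilt y q u"
    by (intro tilt_greatest) (force simp: algebra_simps)
  then show "tilt y q (u + v) \<le> tilt y q u + tilt y q v" by simp
next
  fix r :: real and u assume r: "r > 0"
  have "tilt y q (r *\<^sub>R u) / r \<le> q (u + t *\<^sub>R y) - t * q y" if "t \<ge> 0" for t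
  proof -
    have "tilt y q (r *\<^sub>R u) \<le> q (r *\<^sub>R u + (r * t) *\<^sub>R y) - (r * t) * q y"
      using that r by (intro tilt_le q) auto
    also have "r *\<^sub>R u + (r * t) *\<^sub>R y = r *\<^sub>R (u + t *\<^sub>R y)"
      by (simp add: algebra_simps)
    also have "q (r *\<^sub>R (u + t *\<^sub>R y)) = r * q (u + t *\<^sub>R y)"
      using r by (intro sublinear_scale q) auto
    finally show ?thesis using r by (simp add: field_simps)
  qed
  then have "tilt y q (r *\<^sub>R u) / r \<le> tilt y q u" by (rule tilt_greatest)
  then show "tilt y q (r *\<^sub>R u) \<le> r * tilt y q u" using r by (simp add: field_simps)
qed

lemma tilt_le_self: "sublinear q \<Longrightarrow> tilt y q x \<le> q x"
  using tilt_le[of q 0 y x] by simp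

lemma minimal_sublinear_imp_linear:
  fixes q :: "'a::real_vector \<Rightarrow> real"
  assumes q: "sublinear q"
    and min: "\<And>q'. sublinear q' \<Longrightarrow> q' \<le> q \<Longrightarrow> q' = q"
  shows "linear q"
proof -
  have "tilt y q = q" for y
    by (intro min sublinear_tilt q le_funI tilt_le_self)
  \<comment> \<open>Parameter 1 in the infimum defining the tilt yields superadditivity.\<close>
  then have "q x \<le> q (x + y) - q y" for x y
    using tilt_le[OF q, of 1 y x] by simp
  then have add: "q (x + y) = q x + q y" for x y
    using sublinear_add[OF q, of x y] by (metis antisym le_diff_eq)
  then have minus: "q (- x) = - q x" for x
    using sublinear_zero[OF q] by (metis add_eq_0_iff)
  have "q (r *\<^sub>R x) = r * q x" for r x
  proof (cases "r \<ge> 0")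
    case True
    then show ?thesis by (rule sublinear_scale[OF q])
  next
    case False
    then show ?thesis using sublinear_scale[OF q, of "- r" x] minus[of "r *\<^sub>R x"] by simp
  qed
  then show ?thesis using add by (intro linearI) auto
qed

text \<open>This provides the lower bounds for Zorn's lemma. Subadditivity uses the chain property:
  two members \<open>q\<close> and \<open>q'\<close> can both be replaced by the smaller one. The
  common majorant \<open>p\<close> keeps the infimum finite, since
  \<open>- p (- x) \<le> - q (- x) \<le> q x\<close>.\<close>

lemma sublinear_INF_chain:
  fixes p :: "'a::real_vector \<Rightarrow> real"
  assumes "C \<noteq> {}" and C: "\<And>q. q \<in> C \<Longrightarrow> sublinear q \<and> q \<le> p"
    and chain: "\<And>q q'. q \<in> C \<Longrightarrow> q' \<in> C \<Longrightarrow> q \<le> q' \<or> q' \<le> q"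
  defines "h \<equiv> \<lambda>x. INF q\<in>C. q x"
  shows "sublinear h" and "\<And>q. q \<in> C \<Longrightarrow> h \<le> q"
proof -
  have bdd: "bdd_below ((\<lambda>q. q x) ` C)" for x
  proof (rule bdd_belowI2)
    fix q assume "q \<in> C"
    then have "- q (- x) \<le> q x" "q (- x) \<le> p (- x)"
      using C sublinear_minus by (auto simp: le_fun_def)
    then show "- p (- x) \<le> q x" by linarith
  qed
  have lower: "h x \<le> q x" if "q \<in> C" for q x
    unfolding h_def using that bdd by (intro cINF_lower)
  then show "\<And>q. q \<in> C \<Longrightarrow> h \<le> q" by (auto simp: le_fun_def)
  have greatest: "m \<le> h x" if "\<And>q. q \<in> C \<Longrightarrow> m \<le> q x" for m x
    unfolding h_def using that \<open>C \<noteq> {}\<close> by (intro cINF_greatest)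
  show "sublinear h"
  proof (rule sublinearI)
    fix x y
    have *: "h (x + y) \<le> q x + q' y" if qq: "q \<in> C" "q' \<in> C" for q q'
    proof -
      obtain q'' where "q'' \<in> C" "q'' \<le> q" "q'' \<le> q'" using chain[OF qq] qq by auto
      moreover have "h (x + y) \<le> q'' x + q'' y"
        using lower[OF \<open>q'' \<in> C\<close>] sublinear_add C \<open>q'' \<in> C\<close> by (meson order_trans)
      moreover have "q'' x \<le> q x" "q'' y \<le> q' y"
        using \<open>q'' \<le> q\<close> \<open>q'' \<le> q'\<close> by (simp_all add: le_fun_def)
      ultimately show ?thesis by linarith
    qed
    have "h (x + y) - q x \<le> h y" if "q \<in> C" for q
      by (rule greatest) (use *[OF that] in \<open>simp add: algebra_simps\<close>)
    then have "h (x + y) - h y \<le> h x"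
      by (intro greatest) (simp add: algebra_simps)
    then show "h (x + y) \<le> h x + h y" by simp
  next
    fix r :: real and x assume r: "r > 0"
    have "h (r *\<^sub>R x) / r \<le> h x"
    proof (rule greatest)
      fix q assume q: "q \<in> C"
      have "h (r *\<^sub>R x) \<le> q (r *\<^sub>R x)" by (rule lower[OF q])
      also have "\<dots> = r * q x" using C q r by (intro sublinear_scale) auto
      finally show "h (r *\<^sub>R x) / r \<le> q x" using r by (simp add: field_simps)
    qed
    then show "h (r *\<^sub>R x) \<le> r * h x" using r by (simp add: field_simps)
  qed
qed

theorem linear_below_sublinear:
  fixes p :: "'a::real_vector \<Rightarrow> real"
  assumes "sublinear p"
  obtains u where "linear u" "u \<le> p"
proof -
  define A where "A = {q. sublinear q \<and> q \<le> p}"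
  \<comment> \<open>Zorn's lemma is applied to the reversed order, so its maximal element is a
    minimal functional. It is minimal among all sublinear functionals, because whatever lies below a
    member of \<open>A\<close> is below \<open>p\<close> too.\<close>
  have "\<exists>m\<in>A. \<forall>a\<in>A. m \<ge> a \<longrightarrow> a = m"
  proof (rule predicate_Zorn)
    show "partial_order_on A (relation_of (\<ge>) A)"
      by (rule partial_order_on_relation_ofI) auto
    fix C assume C: "C \<in> Chains (relation_of (\<ge>) A)"
    then have sub: "C \<subseteq> A" by (rule Chains_relation_of)
    show "\<exists>u\<in>A. \<forall>a\<in>C. a \<ge> u"
    proof (cases "C = {}")
      case True
      then show ?thesis using assms by (auto simp: A_def)
    next
      case False
      have ch: "q \<le> q' \<or> q' \<le> q" if "q \<in> C" "q' \<in> C" for q q'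
        using C that by (auto simp: Chains_def relation_of_def)
      have CA: "sublinear q \<and> q \<le> p" if "q \<in> C" for q
        using sub that by (auto simp: A_def)
      note inf = sublinear_INF_chain[OF False CA ch]
      from False obtain q where "q \<in> C" by blast
      then have "(\<lambda>x. INF q\<in>C. q x) \<in> A"
        using inf CA by (auto simp: A_def intro: order_trans)
      then show ?thesis using inf(2) by (intro bexI) auto
    qed
  qed
  then obtain u where "u \<in> A" and min: "\<And>q. q \<in> A \<Longrightarrow> q \<le> u \<Longrightarrow> q = u" by blast
  then have "sublinear u" "u \<le> p" by (auto simp: A_def)
  moreover from this have "linear u"
    by (intro minimal_sublinear_imp_linear min) (auto simp: A_def)
  ultimately show ?thesis using that by blast
qed

text \<open>
  A linear functional below the tilt of the norm is at most \<open>- norm y\<close> at \<open>- y\<close>, so no extension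
  from a line is needed.
\<close>

lemma real_norming_functional:
  fixes y :: "'a::real_normed_vector"
  shows "\<exists>u. linear u \<and> (\<forall>x. u x \<le> norm x) \<and> u y = norm y"
proof -
  obtain u where u: "linear u" "u \<le> tilt y norm"
    by (rule linear_below_sublinear[OF sublinear_tilt[OF sublinear_norm, of y]])
  then have le: "u x \<le> norm x" for x
    using le_funD[OF u(2), of x] tilt_le_self[OF sublinear_norm, of y x] by linarith
  have "u (- y) \<le> - norm y"
    using le_funD[OF u(2), of "- y"] tilt_le[OF sublinear_norm, of 1 y "- y"] by simp
  then have "u y = norm y"
    using linear_neg[OF u(1), of y] le[of y] by simp
  then show ?thesis using u(1) le by blast
qed

section \<open>Norming functionals over the scalar field\<close>

text \<open>The isomorphism of the class is a ring isomorphism preserving the norm, but its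
  compatibility with \<open>of_real\<close> has to be proved. Afterwards only an imaginary unit and
  the formula for the norm are needed, and the isomorphism can be forgotten.\<close>

lemma real_or_complex_field_cases:
  obtains (real) "\<And>z :: 'k::real_or_complex_field. \<exists>r. z = of_real r"
  | (complex) i :: "'k::real_or_complex_field" where "i * i = - 1" "\<And>z. \<exists>a b. z = of_real a + of_real b * i"
      "\<And>a b. norm (of_real a + of_real b * i) = sqrt (a\<^sup>2 + b\<^sup>2)"
  using real_or_complex[where 'a='k]
proof (elim disjE exE conjE)
  fix \<phi> :: "'k \<Rightarrow> real"
  assume b: "bij \<phi>" and add: "\<forall>x y. \<phi> (x + y) = \<phi> x + \<phi> y"
    and mult: "\<forall>x y. \<phi> (x * y) = \<phi> x * \<phi> y" and norm: "\<forall>x. norm (\<phi> x) = norm x"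
  have one: "\<phi> 1 = 1"
  proof -
    have "\<phi> 1 * \<phi> 1 = \<phi> 1" using mult by (metis mult_1)
    moreover have "\<phi> 1 \<noteq> 0" using norm by (metis norm_one norm_zero zero_neq_one)
    ultimately show ?thesis by simp
  qed
  \<comment> \<open>A real number is determined by its distances to 0 and to 1, and
    \<open>\<phi>\<close> preserves both.\<close>
  have "\<phi> (of_real r) = r" for r
  proof -
    have "\<phi> (of_real r - 1) = \<phi> (of_real r) - 1"
      using add[rule_format, of "of_real r - 1" 1] one by simp
    moreover have "norm (of_real r - 1 :: 'k) = \<bar>r - 1\<bar>"
      by (metis norm_of_real of_real_1 of_real_diff)
    ultimately have "\<bar>\<phi> (of_real r)\<bar> = \<bar>r\<bar>" "\<bar>\<phi> (of_real r) - 1\<bar> = \<bar>r - 1\<bar>"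
      using norm[rule_format, of "of_real r"] norm[rule_format, of "of_real r - 1"] by simp_all
    then show ?thesis by linarith
  qed
  then have "z = of_real (\<phi> z)" for z
    using b by (metis bij_pointE)
  then show ?thesis using real by blast
next
  fix \<phi> :: "'k \<Rightarrow> complex"
  assume b: "bij \<phi>" and add: "\<forall>x y. \<phi> (x + y) = \<phi> x + \<phi> y"
    and mult: "\<forall>x y. \<phi> (x * y) = \<phi> x * \<phi> y" and norm: "\<forall>x. norm (\<phi> x) = norm x"
  have inj: "\<phi> x = \<phi> y \<Longrightarrow> x = y" for x y
    using b by (metis bij_pointE)
  have one: "\<phi> 1 = 1"
  proof -
    have "\<phi> 1 * \<phi> 1 = \<phi> 1" using mult by (metis mult_1)
    moreover have "\<phi> 1 \<noteq> 0" using norm by (metis norm_one norm_zero zero_neq_one)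
    ultimately show ?thesis by simp
  qed
  \<comment> \<open>Two circles centred on the real axis determine a real point.\<close>
  have real: "\<phi> (of_real r) = of_real r" for r
  proof -
    have "\<phi> (of_real r - 1) = \<phi> (of_real r) - 1"
      using add[rule_format, of "of_real r - 1" 1] one by simp
    moreover have "norm (of_real r - 1 :: 'k) = \<bar>r - 1\<bar>"
      by (metis norm_of_real of_real_1 of_real_diff)
    ultimately have "cmod (\<phi> (of_real r)) = \<bar>r\<bar>" "cmod (\<phi> (of_real r) - 1) = \<bar>r - 1\<bar>"
      using norm[rule_format, of "of_real r"] norm[rule_format, of "of_real r - 1"] by simp_all
    then have "(cmod (\<phi> (of_real r)))\<^sup>2 = r\<^sup>2" "(cmod (\<phi> (of_real r) - 1))\<^sup>2 = (r - 1)\<^sup>2"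
      by simp_all
    then have "(Re (\<phi> (of_real r)))\<^sup>2 + (Im (\<phi> (of_real r)))\<^sup>2 = r\<^sup>2"
      "Re (\<phi> (of_real r)) = r"
      unfolding cmod_power2 by (simp_all add: power2_eq_square algebra_simps)
    then show ?thesis by (simp add: complex_eq_iff)
  qed
  obtain i where i: "\<phi> i = \<i>" using b by (metis bij_pointE)
  have form: "\<phi> (of_real a + of_real b * i) = Complex a b" for a b
    by (simp add: add mult real i complex_eq_iff)
  have "\<phi> (i * i) = \<phi> (- 1)"
    using real[of "-1"] by (simp add: mult i)
  then have "i * i = - 1" by (rule inj)
  moreover have "\<exists>a b. z = of_real a + of_real b * i" for z
    using form[of "Re (\<phi> z)" "Im (\<phi> z)"] inj by (metis complex.collapse)
  moreover have "norm (of_real a + of_real b * i) = sqrt (a\<^sup>2 + b\<^sup>2)" for a b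
    using norm[rule_format, of "of_real a + of_real b * i"] unfolding form
    by (simp add: cmod_def)
  ultimately show ?thesis by (rule complex)
qed

text \<open>In the complex case a real-linear norming functional \<open>u\<close> is the real part
  of a unique complex-linear one, namely x |-> u(x) - i u(ix), whose norm is no larger.\<close>

lemma exists_norming_linear_map:
  fixes scale :: "'k::real_or_complex_field \<Rightarrow> 'a::real_normed_vector \<Rightarrow> 'a" and y :: 'a
  assumes "normed_space_over scale"
  shows "\<exists>f :: 'a \<Rightarrow> 'k. (\<forall>u v. f (u + v) = f u + f v) \<and> (\<forall>c v. f (scale c v) = c * f v) \<and>
    (\<forall>v. norm (f v) \<le> norm v) \<and> f y = of_real (norm y)"
proof -
  obtain u where u: "linear u" and le: "\<And>x. u x \<le> norm x" and uy: "u y = norm y"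
    using real_norming_functional[of y] by blast
  interpret normed_space_over scale by fact
  have uabs: "\<bar>u x\<bar> \<le> norm x" for x
    using le[of x] le[of "- x"] linear_neg[OF u, of x] by simp
  have uscale: "u (scale (of_real r) x) = r * u x" for r x
    by (simp add: scale_of_real linear_cmul[OF u])
  show ?thesis
  proof (cases rule: real_or_complex_field_cases[where 'k='k])
    case real
    have "of_real (u (scale c v)) = c * of_real (u v)" for c :: 'k and v
    proof -
      obtain r where "c = of_real r" using real by blast
      then show ?thesis by (simp add: uscale)
    qed
    then show ?thesis
      by (intro exI[of _ "\<lambda>x. of_real (u x)"]) (simp add: linear_add[OF u] uabs uy)
  next
    case (complex i)
    define f :: "'a \<Rightarrow> 'k" where "f x = of_real (u x) - of_real (u (scale i x)) * i" for x
    have add: "f (v + w) = f v + f w" for v w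
      by (simp add: f_def linear_add[OF u] scale_right_distrib algebra_simps)
    have fr: "f (scale (of_real r) v) = of_real r * f v" for r v
    proof -
      have "scale i (scale (of_real r) v) = scale (of_real r) (scale i v)"
        by (simp add: mult.commute)
      then show ?thesis by (simp only: f_def uscale) (simp add: algebra_simps)
    qed
    have fi: "f (scale i v) = i * f v" for v
    proof -
      have i2: "i * (z * i) = - z" for z
        using complex(1) by (metis mult.assoc mult.commute mult_minus1)
      have usi: "u (scale i (scale i v)) = - u v"
        by (simp add: complex(1) linear_neg[OF u])
      show ?thesis unfolding f_def right_diff_distrib i2 usi by simp
    qed
    have scale: "f (scale c v) = c * f v" for c v
    proof -
      obtain a b where c: "c = of_real a + of_real b * i" using complex(2) by blast
      have "f (scale c v) = f (scale (of_real a) v) + f (scale (of_real b) (scale i v))"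
        by (simp add: c scale_left_distrib add)
      also have "\<dots> = of_real a * f v + of_real b * (i * f v)" by (simp only: fr fi)
      also have "\<dots> = c * f v" by (simp add: c distrib_right mult.assoc)
      finally show ?thesis .
    qed
    have bound: "norm (f v) \<le> norm v" for v
    proof (cases "f v = 0")
      case False
      \<comment> \<open>The unimodular factor \<open>c\<close> rotates \<open>f v\<close> onto the
        positive real axis, where \<open>f\<close> coincides with its real part
        \<open>u\<close>.\<close>
      define c where "c = of_real (norm (f v)) / f v"
      have c: "norm c = 1" "c * f v = of_real (norm (f v))"
        using False by (simp_all add: c_def norm_divide)
      define w where "w = scale c v"
      have "f w = of_real (norm (f v))" by (simp only: w_def scale c)
      then have "of_real (norm (f v) - u w) + of_real (u (scale i w)) * i = 0"
        by (simp add: f_def algebra_simps)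
      then have "sqrt ((norm (f v) - u w)\<^sup>2 + (u (scale i w))\<^sup>2) = 0"
        using complex(3) by (metis norm_zero)
      then have "norm (f v) = u w" by simp
      also have "\<dots> \<le> norm v" using le[of w] by (simp add: w_def norm_scale c)
      finally show ?thesis .
    qed simp
    \<comment> \<open>The real part of \<open>f y\<close> already has the maximal modulus
      \<open>norm y\<close>, so the imaginary part must vanish.\<close>
    have "norm (f y) = sqrt ((norm y)\<^sup>2 + (- u (scale i y))\<^sup>2)"
      using complex(3)[of "u y" "- u (scale i y)"] by (simp add: f_def uy)
    then have "sqrt ((norm y)\<^sup>2 + (u (scale i y))\<^sup>2) \<le> norm y" using bound[of y] by simp
    then have "u (scale i y) = 0" using sqrt_le_D by fastforce
    then have "f y = of_real (norm y)" by (simp add: f_def uy)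
    then show ?thesis using add scale bound by blast
  qed
qed

section \<open>Operator norm and numerical radius on a subspace\<close>

lemma bounded_linear_scale:
  assumes "normed_space_over s" shows "bounded_linear (s c)"
proof -
  interpret normed_space_over s by fact
  show ?thesis
  proof (rule bounded_linear_intro)
    show "s c (r *\<^sub>R x) = r *\<^sub>R s c x" for r x
      by (simp add: mult.commute flip: scale_of_real)
    show "norm (s c x) \<le> norm x * norm c" for x
      by (simp add: norm_scale)
  qed (rule scale_right_distrib)
qed

lemma bounded_linear_on_zero:
  assumes "normed_space_over s" "normed_space_over s'" "bounded_linear_on s s' Z f" "x \<in> Z"
  shows "f 0 = 0"
proof -
  interpret s: normed_space_over s by fact
  interpret s': normed_space_over s' by fact
  have "f (s 0 x) = s' 0 (f x)" using assms(3,4) unfolding bounded_linear_on_def by blast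
  then show ?thesis by simp
qed

lemma norm_le_onorm_on:
  assumes "normed_space_over s" "normed_space_over s'" "module.subspace s Z"
    "bounded_linear_on s s' Z f" "x \<in> Z"
  shows "norm (f x) \<le> onorm_on Z f * norm x"
proof (cases "x = 0")
  case True
  then show ?thesis using bounded_linear_on_zero[OF assms(1,2,4,5)] by simp
next
  case False
  interpret s: normed_space_over s by fact
  interpret s': normed_space_over s' by fact
  from assms(4) obtain K where K: "\<And>x. x \<in> Z \<Longrightarrow> norm (f x) \<le> K * norm x"
    unfolding bounded_linear_on_def by blast
  have bdd: "bdd_above ((\<lambda>x. norm (f x)) ` {x \<in> Z. norm x \<le> 1})"
  proof (rule bdd_aboveI2)
    fix x assume x: "x \<in> {x \<in> Z. norm x \<le> 1}"
    then have "norm (f x) \<le> K * norm x" using K by simp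
    \<comment> \<open>The sign of \<open>K\<close> is not prescribed, hence the absolute
      value.\<close>
    also have "\<dots> \<le> \<bar>K\<bar> * norm x" by (simp add: mult_right_mono)
    also have "\<dots> \<le> \<bar>K\<bar>" using x by (simp add: mult_left_le)
    finally show "norm (f x) \<le> \<bar>K\<bar>" .
  qed
  define c where "c = (of_real (inverse (norm x)) :: 'a)"
  have "s c x \<in> Z" "norm (s c x) = 1"
    using s.subspace_scale[OF assms(3,5)] False by (simp_all add: s.norm_scale c_def norm_inverse)
  then have "norm (f (s c x)) \<le> onorm_on Z f"
    unfolding onorm_on_def using bdd by (intro cSUP_upper) auto
  moreover have "norm (f (s c x)) = inverse (norm x) * norm (f x)"
    using assms(4,5) by (simp add: bounded_linear_on_def s'.norm_scale c_def norm_inverse)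
  ultimately show ?thesis using False by (simp add: field_simps)
qed

lemma onorm_on_eq_one:
  assumes "\<And>x. x \<in> Z \<Longrightarrow> norm (f x) \<le> norm x" "z \<in> Z" "norm z = 1" "norm (f z) = 1"
  shows "onorm_on Z f = 1"
  unfolding onorm_on_def
proof (rule cSup_eq_maximum)
  show "1 \<in> (\<lambda>x. norm (f x)) ` {x \<in> Z. norm x \<le> 1}"
    using assms by (auto intro!: image_eqI[of _ _ z])
qed (use assms(1) in \<open>force intro: order_trans\<close>)

lemma norm_le_if_norming:
  assumes "normed_space_over s" "module.subspace s Z" "norming_functional s Z z f" "x \<in> Z"
  shows "norm (f x) \<le> norm x"
  using norm_le_onorm_on[OF assms(1) normed_space_over_mult assms(2) _ assms(4), of f] assms(3)
  by (simp add: norming_functional_def dual_on_def)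

lemma norming_functionalI:
  assumes "normed_space_over s" "module.subspace s Z" "z \<in> Z" "z \<noteq> 0"
    and "bounded_linear_on s (*) Z f" "\<And>v. v \<in> Z \<Longrightarrow> norm (f v) \<le> norm v" "f z = of_real (norm z)"
  shows "norming_functional s Z z f"
proof -
  interpret normed_space_over s by fact
  define w where "w = s (of_real (inverse (norm z))) z"
  have w: "w \<in> Z" "norm w = 1"
    using subspace_scale[OF assms(2,3)] assms(4) by (simp_all add: w_def norm_scale norm_inverse)
  have "f w = of_real (inverse (norm z)) * f z"
    using assms(3,5) unfolding w_def bounded_linear_on_def by blast
  then have "norm (f w) = 1"
    using assms(4) by (simp add: assms(7) norm_mult norm_inverse)
  then have "onorm_on Z f = 1"
    using w assms(6) by (intro onorm_on_eq_one[of Z f w])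
  then show ?thesis
    using assms by (simp add: norming_functional_def dual_on_def)
qed

lemma exists_norming_functional:
  assumes "normed_space_over s" "z \<noteq> 0"
  shows "\<exists>f. norming_functional s UNIV z f"
proof -
  interpret normed_space_over s by fact
  obtain f where "\<forall>u v. f (u + v) = f u + f v" "\<forall>c v. f (s c v) = c * f v"
    "\<forall>v. norm (f v) \<le> norm v" "f z = of_real (norm z)"
    using exists_norming_linear_map[OF assms(1), of z] by blast
  then have "norming_functional s UNIV z f"
    using assms by (intro norming_functionalI) (auto simp: bounded_linear_on_def intro!: exI[of _ 1])
  then show ?thesis by blast
qed

text \<open>Restriction does not lower the norm, because it is attained in the direction of
  \<open>z\<close>, which lies in \<open>Z\<close>.\<close>

lemma norming_functional_subspace:
  assumes "normed_space_over s" "module.subspace s Z" "z \<in> Z" "norming_functional s UNIV z f"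
  shows "norming_functional s Z z f"
proof -
  interpret normed_space_over s by fact
  have "norm (f v) \<le> norm v" for v
    using norm_le_if_norming[OF assms(1) subspace_UNIV assms(4)] by simp
  moreover have "bounded_linear_on s (*) Z f"
    using assms(4) by (auto simp: norming_functional_def dual_on_def bounded_linear_on_def)
  ultimately show ?thesis
    using assms by (intro norming_functionalI) (auto simp: norming_functional_def)
qed

text \<open>The numerical radius and the LCC speak of unit vectors, while the estimates below are
  homogeneous; this lemma translates between the two.\<close>

lemma norming_functional_normalize:
  assumes "normed_space_over s" "module.subspace s Z" "norming_functional s Z z f" "r > 0"
  shows "norming_functional s Z (s (of_real r) z) f"
proof -
  interpret normed_space_over s by fact
  show ?thesis
    using assms subspace_scale[OF assms(2), of z "of_real r"]
    by (auto simp: norming_functional_def norm_scale dual_on_def bounded_linear_on_def)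
qed

text \<open>The operator norm of \<open>T\<close> bounds the set in the definition, so its supremum
  is a genuine upper bound; scaling removes the restriction to unit vectors.\<close>

lemma norm_le_numerical_radius:
  assumes s: "normed_space_over s" and Z: "module.subspace s Z" and T: "T \<in> operators_on s Z"
    and f: "norming_functional s Z z f"
  shows "norm (f (T z)) \<le> numerical_radius s Z T * norm z"
proof -
  interpret normed_space_over s by fact
  let ?W = "{norm (f (T x)) | x f. x \<in> Z \<and> norm x = 1 \<and>
            f \<in> dual_on s Z \<and> onorm_on Z f = 1 \<and> f x = 1}"
  have TZ: "T x \<in> Z" if "x \<in> Z" for x using T that by (auto simp: operators_on_def)
  have Tlin: "bounded_linear_on s s Z T" using T by (simp add: operators_on_def)
  have bdd: "bdd_above ?W"
  proof (rule bdd_aboveI)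
    fix t assume "t \<in> ?W"
    then obtain x f where x: "t = norm (f (T x))" "x \<in> Z" "norm x = 1"
      "f \<in> dual_on s Z" "onorm_on Z f = 1" "f x = 1" by blast
    then have "norming_functional s Z x f" by (auto simp: norming_functional_def)
    then have "t \<le> norm (T x)"
      using norm_le_if_norming[OF s Z] TZ x by blast
    also have "\<dots> \<le> onorm_on Z T"
      using norm_le_onorm_on[OF s s Z Tlin, of x] x by simp
    finally show "t \<le> onorm_on Z T" .
  qed
  define r where "r = inverse (norm z)"
  define w where "w = s (of_real r) z"
  have z: "z \<in> Z" "z \<noteq> 0" using f by (auto simp: norming_functional_def)
  then have r: "r > 0" "norm w = 1" by (simp_all add: r_def w_def norm_scale norm_inverse)
  have "norming_functional s Z w f"
    unfolding w_def by (rule norming_functional_normalize[OF s Z f r(1)])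
  then have "norm (f (T w)) \<in> ?W"
    using r by (auto simp: norming_functional_def)
  then have "norm (f (T w)) \<le> numerical_radius s Z T"
    unfolding numerical_radius_def using bdd by (rule cSup_upper)
  moreover have "f (T w) = of_real r * f (T z)"
    using f Tlin z TZ by (simp add: w_def bounded_linear_on_def norming_functional_def dual_on_def)
  ultimately show ?thesis
    using z r(1) by (simp add: norm_mult r_def norm_inverse norm_divide field_simps)
qed

text \<open>The nonzero vector supplies a norming functional; on the zero subspace the supremum
  would be over the empty set.\<close>

lemma numerical_radius_nonneg:
  assumes s: "normed_space_over s" and Z: "module.subspace s Z" and T: "T \<in> operators_on s Z"
    and z: "z \<in> Z" "z \<noteq> 0"
  shows "numerical_radius s Z T \<ge> 0"
proof -
  obtain f where "norming_functional s UNIV z f"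
    using exists_norming_functional[OF s z(2)] by blast
  then have "norming_functional s Z z f"
    by (rule norming_functional_subspace[OF s Z z(1)])
  then have "0 \<le> numerical_radius s Z T * norm z"
    using norm_le_numerical_radius[OF s Z T] by (meson norm_ge_zero order_trans)
  then show ?thesis using z by (simp add: zero_le_mult_iff)
qed

section \<open>Estimates on dense sets\<close>

text \<open>A linear contraction is uniformly continuous, so it extends to the closure by
  completeness. Linearity and the bound pass to limits of sequences in \<open>V\<close>.\<close>

lemma extend_bounded_linear_on:
  fixes s :: "'k::real_or_complex_field \<Rightarrow> 'a::banach \<Rightarrow> 'a"
  assumes s: "normed_space_over s" and V: "module.subspace s V" and dense: "closure V = UNIV"
    and add: "\<And>x y. x \<in> V \<Longrightarrow> y \<in> V \<Longrightarrow> R (x + y) = R x + R y"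
    and scale: "\<And>c x. x \<in> V \<Longrightarrow> R (s c x) = s c (R x)"
    and bound: "\<And>x. x \<in> V \<Longrightarrow> norm (R x) \<le> norm x"
  obtains S where "bounded_linear_on s s UNIV S" "\<And>x. x \<in> V \<Longrightarrow> S x = R x"
    "\<And>x. norm (S x) \<le> norm x"
proof -
  interpret normed_space_over s by fact
  have "dist (R x) (R y) \<le> dist x y" if "x \<in> V" "y \<in> V" for x y
  proof -
    have diff: "R (x - y) + R y = R x"
      using add[OF subspace_diff[OF V that] that(2)] by simp
    then show ?thesis
      using bound[OF subspace_diff[OF V that]] by (simp add: dist_norm flip: diff)
  qed
  then have "uniformly_continuous_on V R"
    unfolding uniformly_continuous_on_def by (meson le_less_trans)
  then obtain S where "uniformly_continuous_on (closure V) S" and SR: "\<And>x. x \<in> V \<Longrightarrow> R x = S x"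
    using uniformly_continuous_on_extension_on_closure[of V R] by metis
  then have "continuous_on UNIV S"
    using dense uniformly_continuous_imp_continuous by metis
  then have lim: "(\<lambda>n. S (a n)) \<longlonglongrightarrow> S x" if "a \<longlonglongrightarrow> x" for a x
    using that by (simp add: continuous_on_sequentially comp_def)
  have approx: "\<exists>a. (\<forall>n. a n \<in> V) \<and> a \<longlonglongrightarrow> x" for x
    using dense closure_sequential[of x V] by simp
  have Sadd: "S (x + y) = S x + S y" for x y
  proof -
    obtain a b where a: "\<And>n. a n \<in> V" "a \<longlonglongrightarrow> x" and b: "\<And>n. b n \<in> V" "b \<longlonglongrightarrow> y"
      using approx by metis
    have "(\<lambda>n. S (a n + b n)) \<longlonglongrightarrow> S (x + y)" by (intro lim tendsto_add a b)
    moreover have "S (a n + b n) = S (a n) + S (b n)" for n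
      using add[OF a(1) b(1)] SR subspace_add[OF V a(1) b(1)] a(1) b(1) by metis
    moreover have "(\<lambda>n. S (a n) + S (b n)) \<longlonglongrightarrow> S x + S y" by (intro tendsto_add lim a b)
    ultimately show ?thesis by (simp add: LIMSEQ_unique)
  qed
  have Sscale: "S (s c x) = s c (S x)" for c x
  proof -
    obtain a where a: "\<And>n. a n \<in> V" "a \<longlonglongrightarrow> x" using approx by metis
    note tend = bounded_linear.tendsto[OF bounded_linear_scale[OF s, of c]]
    have "(\<lambda>n. S (s c (a n))) \<longlonglongrightarrow> S (s c x)" by (intro lim tend a)
    moreover have "S (s c (a n)) = s c (S (a n))" for n
      using scale[OF a(1)] SR subspace_scale[OF V a(1)] a(1) by metis
    moreover have "(\<lambda>n. s c (S (a n))) \<longlonglongrightarrow> s c (S x)" by (intro tend lim a)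
    ultimately show ?thesis by (simp add: LIMSEQ_unique)
  qed
  have Sbound: "norm (S x) \<le> norm x" for x
  proof -
    obtain a where a: "\<And>n. a n \<in> V" "a \<longlonglongrightarrow> x" using approx by metis
    show ?thesis
    proof (rule LIMSEQ_le)
      show "(\<lambda>n. norm (S (a n))) \<longlonglongrightarrow> norm (S x)" "(\<lambda>n. norm (a n)) \<longlonglongrightarrow> norm x"
        by (intro tendsto_norm lim a)+
      show "\<exists>N. \<forall>n\<ge>N. norm (S (a n)) \<le> norm (a n)"
        using bound[OF a(1)] SR[OF a(1)] by simp
    qed
  qed
  have "bounded_linear_on s s UNIV S"
    unfolding bounded_linear_on_def using Sadd Sscale Sbound by (auto intro!: exI[of _ 1])
  then show ?thesis using that SR Sbound by metis
qed

text \<open>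
  A bound for norming functionals at the points of a dense set cannot be passed to the limit
  directly, since a functional norming \<open>x\<close> need not norm nearby points.  The bound is therefore
  first turned into a lower bound for \<open>norm (y - a S y)\<close>, which does pass to the limit.
\<close>

lemma norm_diff_ge:
  assumes s: "normed_space_over s" and dense: "closure V = UNIV"
    and S: "bounded_linear_on s s UNIV S" and Sbound: "\<And>x. norm (S x) \<le> norm x"
    and V: "\<And>y f. y \<in> V \<Longrightarrow> norming_functional s UNIV y f \<Longrightarrow> norm (f (S y)) \<le> \<mu> * norm y"
  shows "norm (y - s a (S y)) \<ge> (1 - norm a * \<mu>) * norm y"
proof -
  interpret normed_space_over s by fact
  have on_V: "norm (y - s a (S y)) \<ge> (1 - norm a * \<mu>) * norm y" if "y \<in> V" for y
  proof (cases "y = 0")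
    case False
    obtain f where norming: "norming_functional s UNIV y f"
      using exists_norming_functional[OF s False] by blast
    then have f: "f (u + v) = f u + f v" "f (s c u) = c * f u" "f y = of_real (norm y)" for u v c
      by (simp_all add: norming_functional_def dual_on_def bounded_linear_on_def)
    have "norm (f (S y)) \<le> \<mu> * norm y" by (rule V[OF that norming])
    then have "norm a * norm (f (S y)) \<le> norm a * (\<mu> * norm y)" by (simp add: mult_left_mono)
    moreover have "f (y - s a (S y)) + a * f (S y) = f y"
      using f(1)[of "y - s a (S y)" "s a (S y)"] f(2) by simp
    then have "norm (f y) \<le> norm (f (y - s a (S y))) + norm a * norm (f (S y))"
      by (metis norm_mult norm_triangle_ineq)
    moreover have "norm (f (y - s a (S y))) \<le> norm (y - s a (S y))" 
      using norm_le_if_norming[OF s subspace_UNIV norming] by simp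
    moreover have "norm (f y) = norm y" by (simp add: f(3))
    ultimately show ?thesis by (simp add: algebra_simps)
  qed simp
  have "bounded_linear S"
  proof (rule bounded_linear_intro)
    show "S (r *\<^sub>R x) = r *\<^sub>R S x" for r x
      using S by (simp add: bounded_linear_on_def flip: scale_of_real)
    show "S (x + y) = S x + S y" for x y using S by (simp add: bounded_linear_on_def)
    show "norm (S x) \<le> norm x * 1" for x using Sbound by simp
  qed
  then have cont: "continuous_on UNIV (\<lambda>y. s a (S y))"
    using bounded_linear_scale[OF s] by (intro linear_continuous_on bounded_linear_compose[of "s a" S])
  have "closed {y. (1 - norm a * \<mu>) * norm y \<le> norm (y - s a (S y))}"
    by (intro closed_Collect_le continuous_intros cont)
  moreover have "V \<subseteq> {y. (1 - norm a * \<mu>) * norm y \<le> norm (y - s a (S y))}"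
    using on_V by blast
  ultimately have "closure V \<subseteq> {y. (1 - norm a * \<mu>) * norm y \<le> norm (y - s a (S y))}"
    by (rule closure_minimal[rotated])
  then show ?thesis using dense by blast
qed

lemma numerical_radius_le_if_dense:
  fixes s :: "'k::real_or_complex_field \<Rightarrow> 'a::real_normed_vector \<Rightarrow> 'a" and z :: 'a
  assumes s: "normed_space_over s" and dense: "closure V = UNIV"
    and S: "bounded_linear_on s s UNIV S" and Sbound: "\<And>x. norm (S x) \<le> norm x"
    and V: "\<And>y f. y \<in> V \<Longrightarrow> norming_functional s UNIV y f \<Longrightarrow> norm (f (S y)) \<le> \<mu> * norm y"
    and "\<mu> \<ge> 0" and z: "z \<noteq> 0"
  shows "numerical_radius s UNIV S \<le> \<mu>"
proof -
  interpret normed_space_over s by fact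
  have Slin: "S (x + y) = S x + S y" "S (s c x) = s c (S x)" for x y c
    using S by (simp_all add: bounded_linear_on_def)
  have diff_ge: "(1 - norm a * \<mu>) * norm y \<le> norm (y - s a (S y))" for a y
    by (rule norm_diff_ge[where V = V, OF s dense S Sbound]) (rule V)
  have le: "norm (f (S x)) \<le> \<mu>"
    if x: "norm x = 1" "f \<in> dual_on s UNIV" "onorm_on UNIV f = 1" "f x = 1" for x f
  proof (cases "f (S x) = 0")
    case False
    define t where "t = norm (f (S x))"
    have t: "t > 0" using False by (simp add: t_def)
    have flin: "f (u + v) = f u + f v" "f (s c u) = c * f u" for u v c
      using x(2) by (simp_all add: dual_on_def bounded_linear_on_def)
    have "norming_functional s UNIV x f"
      using x by (auto simp: norming_functional_def)
    then have fle: "norm (f u) \<le> norm u" for u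
      using norm_le_if_norming[OF s subspace_UNIV] by simp
    \<comment> \<open>The condition \<open>\<alpha> * \<mu> \<le> 1\<close> keeps the factor
      \<open>1 - \<alpha> * \<mu>\<close> nonnegative, so that it may multiply the lower bound for
      \<open>norm y\<close>.\<close>
    have main: "t - \<mu> - \<alpha> * (\<mu> * t) \<le> \<alpha>" if \<alpha>: "\<alpha> > 0" "\<alpha> * \<mu> \<le> 1" for \<alpha>
    proof -
      define a where "a = of_real (\<alpha> * t) / f (S x)"
      have na: "norm a = \<alpha>" and fa: "a * f (S x) = of_real (\<alpha> * t)"
        using \<alpha> False t by (simp_all add: a_def norm_divide norm_mult t_def)
      \<comment> \<open>With this \<open>y\<close> the first-order terms of
        \<open>y - s a (S y)\<close> cancel and only a term of size at most
        \<open>\<alpha> * \<alpha>\<close> remains, whereas \<open>f y\<close> grows to first order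
        in \<open>\<alpha>\<close>.\<close>
      define y where "y = x + s a (S x)"
      have "f y = of_real (1 + \<alpha> * t)"
        by (simp add: y_def flin fa x(4))
      moreover have "\<bar>1 + \<alpha> * t\<bar> = 1 + \<alpha> * t" using \<alpha> t by (simp add: add_nonneg_nonneg)
      ultimately have "1 + \<alpha> * t \<le> norm y" using fle[of y] by (metis norm_of_real)
      then have "(1 - \<alpha> * \<mu>) * (1 + \<alpha> * t) \<le> (1 - \<alpha> * \<mu>) * norm y"
        using \<alpha> by (intro mult_left_mono) auto
      also have "\<dots> \<le> norm (y - s a (S y))"
        using diff_ge[of a y] na by simp
      also have "y - s a (S y) = x - s (a * a) (S (S x))"
        by (simp add: y_def Slin scale_right_distrib)
      also have "norm \<dots> \<le> norm x + norm (s (a * a) (S (S x)))" by (rule norm_triangle_ineq4)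
      also have "norm (s (a * a) (S (S x))) \<le> (\<alpha> * \<alpha>) * norm (S (S x))"
        by (simp add: norm_scale norm_mult na)
      also have "norm (S (S x)) \<le> 1" using Sbound[of "S x"] Sbound[of x] x(1) by linarith
      finally have "(1 - \<alpha> * \<mu>) * (1 + \<alpha> * t) \<le> 1 + \<alpha> * \<alpha>"
        using \<alpha> x(1) by (simp add: mult_left_mono)
      then have "\<alpha> * (t - \<mu> - \<alpha> * (\<mu> * t)) \<le> \<alpha> * \<alpha>" by (simp add: algebra_simps)
      then show ?thesis using \<alpha> by simp
    qed
    have "((\<lambda>\<alpha>. \<alpha> - (t - \<mu> - \<alpha> * (\<mu> * t))) \<longlongrightarrow> 0 - (t - \<mu> - 0 * (\<mu> * t))) (at_right 0)"
      by (intro tendsto_intros)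
    moreover have "\<forall>\<^sub>F \<alpha> in at_right 0. 0 \<le> \<alpha> - (t - \<mu> - \<alpha> * (\<mu> * t))"
    proof -
      \<comment> \<open>The denominator \<open>1 + \<mu>\<close> instead of \<open>\<mu>\<close>
        also covers \<open>\<mu> = 0\<close>.\<close>
      have "\<forall>\<^sub>F \<alpha> in at_right 0. \<alpha> < 1 / (1 + \<mu>)"
        using \<open>\<mu> \<ge> 0\<close> by (intro eventually_at_right_less eventually_at_rightI[of 0]) auto
      then show ?thesis
        using eventually_at_right_less[of 0]
      proof eventually_elim
        case (elim \<alpha>)
        then have "\<alpha> * \<mu> \<le> 1" using \<open>\<mu> \<ge> 0\<close> by (simp add: field_simps)
        then show ?case using main elim by simp
      qed
    qed
    ultimately have "0 \<le> 0 - (t - \<mu> - 0 * (\<mu> * t))"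
      by (rule tendsto_lowerbound) simp
    then show ?thesis by (simp add: t_def)
  qed (use \<open>\<mu> \<ge> 0\<close> in simp)
  \<comment> \<open>A least upper bound argument needs a nonempty set; the normalized
    \<open>z\<close> with a norming functional provides a member.\<close>
  obtain f where "norming_functional s UNIV z f"
    using exists_norming_functional[OF s z] by blast
  then have "norming_functional s UNIV (s (of_real (inverse (norm z))) z) f"
    using s z by (intro norming_functional_normalize) auto
  moreover have "norm (s (of_real (inverse (norm z))) z) = 1"
    using z by (simp add: norm_scale norm_inverse)
  ultimately have "\<exists>x f. norm x = 1 \<and> f \<in> dual_on s UNIV \<and> onorm_on UNIV f = 1 \<and> f x = 1"
    unfolding norming_functional_def by (metis of_real_1)
  then show ?thesis
    unfolding numerical_radius_def using le by (intro cSup_least) auto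
qed

section \<open>Chains of norm-one projections\<close>

locale projection_chain = normed_space_over s
  for s :: "'k::real_or_complex_field \<Rightarrow> 'a::banach \<Rightarrow> 'a" +
  fixes X :: "nat \<Rightarrow> 'a set" and P :: "nat \<Rightarrow> 'a \<Rightarrow> 'a"
  assumes subspace_X: "subspace (X n)"
    and mono_X: "X n \<subseteq> X (Suc n)"
    and dense_X: "closure (\<Union>n. X n) = UNIV"
    and projection: "projection_onto s (X (Suc n)) (X n) (P n)"
    and norm_P: "onorm_on (X (Suc n)) (P n) = 1"
    and LCC: "local_characterization_condition s X P"
begin

lemma X_le: "i \<le> j \<Longrightarrow> X i \<subseteq> X j"
  by (rule lift_Suc_mono_le[of X]) (use mono_X in auto)

lemma P_mem: "x \<in> X (Suc n) \<Longrightarrow> P n x \<in> X n"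
  using projection[of n] by (auto simp: projection_onto_def)

lemma P_bounded_linear_on: "bounded_linear_on s s (X (Suc n)) (P n)"
  using projection[of n] by (simp add: projection_onto_def)

lemma P_add: "x \<in> X (Suc n) \<Longrightarrow> y \<in> X (Suc n) \<Longrightarrow> P n (x + y) = P n x + P n y"
  and P_scale: "x \<in> X (Suc n) \<Longrightarrow> P n (s c x) = s c (P n x)"
  using P_bounded_linear_on[of n] unfolding bounded_linear_on_def by blast+

lemma P_id:
  assumes "x \<in> X n" shows "P n x = x"
proof -
  obtain z where "z \<in> X (Suc n)" "x = P n z"
    using projection[of n] assms by (auto simp: projection_onto_def)
  then show ?thesis using projection[of n] by (auto simp: projection_onto_def)
qed

lemma P_norm_le:
  assumes "x \<in> X (Suc n)" shows "norm (P n x) \<le> norm x"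
  using norm_le_onorm_on[OF normed_space_over_axioms normed_space_over_axioms subspace_X
      P_bounded_linear_on assms] by (simp add: norm_P)

text \<open>If \<open>X n\<close> were zero, the projection onto it would vanish and could not have
  norm one.\<close>

lemma X_nontrivial: "\<exists>z \<in> X n. z \<noteq> 0"
proof (rule ccontr)
  assume "\<not> ?thesis"
  then have "P n x = 0" if "x \<in> X (Suc n)" for x
    using P_mem[OF that] by blast
  then have "onorm_on (X (Suc n)) (P n) = (SUP x \<in> {x \<in> X (Suc n). norm x \<le> 1}. 0)"
    unfolding onorm_on_def by (intro SUP_cong) auto
  moreover have "0 \<in> {x \<in> X (Suc n). norm x \<le> 1}"
    using subspace_0[OF subspace_X] by simp
  ultimately show False
    using norm_P[of n] by (metis cSUP_const empty_iff zero_neq_one)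
qed

lemma X_unit: "\<exists>z \<in> X n. norm z = 1"
proof -
  obtain z where "z \<in> X n" "z \<noteq> 0" using X_nontrivial by blast
  then have "s (of_real (inverse (norm z))) z \<in> X n" "norm (s (of_real (inverse (norm z))) z) = 1"
    by (simp_all add: subspace_scale[OF subspace_X] norm_scale norm_inverse)
  then show ?thesis by blast
qed

text \<open>This is the composition T o P_m o ... o P_(m+k-1), meaningful on
  \<open>X (m + k)\<close>; the projection with the highest index acts first.\<close>

primrec pull_back :: "nat \<Rightarrow> ('a \<Rightarrow> 'a) \<Rightarrow> nat \<Rightarrow> 'a \<Rightarrow> 'a" where
  "pull_back m T 0 = T"
| "pull_back m T (Suc k) = (\<lambda>x. pull_back m T k (P (m + k) x))"

context
  fixes m :: nat and T :: "'a \<Rightarrow> 'a"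
  assumes T: "T \<in> operators_on s (X m)" and norm_T: "onorm_on (X m) T = 1"
begin

lemma pull_back_add:
  "x \<in> X (m + k) \<Longrightarrow> y \<in> X (m + k) \<Longrightarrow>
    pull_back m T k (x + y) = pull_back m T k x + pull_back m T k y"
proof (induction k arbitrary: x y)
  case 0
  then show ?case using T by (simp add: operators_on_def bounded_linear_on_def)
next
  case (Suc k)
  then show ?case by (simp add: P_add P_mem)
qed

lemma pull_back_scale:
  "x \<in> X (m + k) \<Longrightarrow> pull_back m T k (s c x) = s c (pull_back m T k x)"
proof (induction k arbitrary: x)
  case 0
  then show ?case using T by (simp add: operators_on_def bounded_linear_on_def)
next
  case (Suc k)
  then show ?case by (simp add: P_scale P_mem)
qed

lemma pull_back_norm_le: "x \<in> X (m + k) \<Longrightarrow> norm (pull_back m T k x) \<le> norm x"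
proof (induction k arbitrary: x)
  case 0
  then show ?case
    using norm_le_onorm_on[OF normed_space_over_axioms normed_space_over_axioms subspace_X, of m T x]
      T norm_T by (simp add: operators_on_def)
next
  case (Suc k)
  then have "norm (pull_back m T k (P (m + k) x)) \<le> norm (P (m + k) x)"
    by (simp add: P_mem)
  then show ?case using P_norm_le[of x "m + k"] Suc.prems by simp
qed

text \<open>The additional projections fix \<open>x\<close>. Hence the operators at different levels
  agree where both make sense and glue to one map on the union.\<close>

lemma pull_back_stable:
  assumes "x \<in> X (m + k)" shows "pull_back m T (k + j) x = pull_back m T k x"
proof (induction j)
  case (Suc j)
  have "x \<in> X (m + (k + j))" using assms X_le[of "m + k" "m + (k + j)"] by auto
  then show ?case using Suc by (simp add: P_id)
qed simp

text \<open>The functional is generalized in the induction, because the hypothesis is applied to the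
  multiple of \<open>f\<close> that the LCC provides for the projected vector.\<close>

lemma pull_back_numerical_range:
  "norming_functional s (X (m + k)) x f \<Longrightarrow>
    norm (f (pull_back m T k x)) \<le> numerical_radius s (X m) T * norm x"
proof (induction k arbitrary: x f)
  case 0
  then show ?case
    using norm_le_numerical_radius[OF normed_space_over_axioms subspace_X T] by simp
next
  case (Suc k)
  let ?n = "m + k" and ?\<nu> = "numerical_radius s (X m) T"
  have \<nu>: "?\<nu> \<ge> 0"
    using numerical_radius_nonneg[OF normed_space_over_axioms subspace_X T] X_nontrivial by blast
  define r where "r = inverse (norm x)"
  define w where "w = s (of_real r) x"
  have x: "x \<in> X (Suc ?n)" "x \<noteq> 0" using Suc.prems by (auto simp: norming_functional_def)
  then have r: "r > 0" "norm w = 1" by (simp_all add: r_def w_def norm_scale norm_inverse)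
  have f: "norming_functional s (X (Suc ?n)) w f"
    unfolding w_def
    using norming_functional_normalize[OF normed_space_over_axioms subspace_X _ r(1)] Suc.prems by simp
  have w: "w \<in> X (Suc ?n)" using f by (simp add: norming_functional_def)
  have pw: "pull_back m T (Suc k) w = s (of_real r) (pull_back m T (Suc k) x)"
    unfolding w_def by (rule pull_back_scale) (use x in simp)
  have f0: "bounded_linear_on s (*) (X (Suc ?n)) f"
    using f by (simp add: norming_functional_def dual_on_def)
  have Xk: "X m \<subseteq> X (Suc ?n)" by (rule X_le) simp
  have mem: "pull_back m T j y \<in> X m" if "y \<in> X (m + j)" for j y
    using that
  proof (induction j arbitrary: y)
    case 0
    then show ?case using T by (auto simp: operators_on_def)
  qed (simp add: P_mem)
  have "norm (f (pull_back m T (Suc k) w)) \<le> ?\<nu>"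
  proof (cases "P ?n w = 0")
    \<comment> \<open>The LCC says nothing here, but the pulled-back operator sends \<open>w\<close>
      to 0.\<close>
    case True
    have "pull_back m T k 0 = 0"
      using pull_back_add[of 0 k 0] subspace_0[OF subspace_X] by simp
    moreover have "f 0 = 0"
      using bounded_linear_on_zero[OF normed_space_over_axioms normed_space_over_mult f0 w] .
    ultimately show ?thesis using True \<nu> by simp
  next
    case False
    then obtain b :: real where
      b: "norming_functional s (X ?n) (P ?n w) (\<lambda>y. of_real b * f y)"
      using LCC f w r(2) unfolding local_characterization_condition_def by blast
    have Pw: "P ?n w \<in> X (Suc ?n)" using P_mem[OF w] mono_X by blast
    have "norm (P ?n w) = norm (of_real b * f (P ?n w))"
      using b by (simp add: norming_functional_def)
    also have "\<dots> = \<bar>b\<bar> * norm (f (P ?n w))" by (simp add: norm_mult)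
    also have "\<dots> \<le> \<bar>b\<bar> * norm (P ?n w)"
      using norm_le_if_norming[OF normed_space_over_axioms subspace_X f Pw] by (simp add: mult_left_mono)
    \<comment> \<open>Since \<open>f\<close> has norm one, its multiple by \<open>b\<close> can norm
      the projected vector only if \<open>\<bar>b\<bar>\<close> is at least 1. Dropping
      \<open>b\<close> therefore only decreases the quantity bounded by the induction
      hypothesis.\<close>
    finally have b1: "1 \<le> \<bar>b\<bar>" using False by simp
    let ?v = "norm (f (pull_back m T k (P ?n w)))"
    have "1 * ?v \<le> \<bar>b\<bar> * ?v" by (rule mult_right_mono[OF b1]) simp
    also have "\<dots> \<le> ?\<nu> * norm (P ?n w)" using Suc.IH[OF b] by (simp add: norm_mult)
    also have "\<dots> \<le> ?\<nu> * 1"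
      using P_norm_le[OF w] r(2) \<nu> by (intro mult_left_mono) auto
    finally show ?thesis by simp
  qed
  moreover have "f (pull_back m T (Suc k) w) = of_real r * f (pull_back m T (Suc k) x)"
    unfolding pw using f0 mem[of x "Suc k"] Xk x by (auto simp: bounded_linear_on_def)
  ultimately have "r * norm (f (pull_back m T (Suc k) x)) \<le> ?\<nu>"
    using r(1) by (simp only: norm_mult norm_of_real abs_of_pos)
  then show ?case using x by (simp add: r_def field_simps)
qed

lemma extension_to_limit:
  obtains S where "S \<in> operators_on s UNIV" "onorm_on UNIV S = 1"
    "numerical_radius s UNIV S \<le> numerical_radius s (X m) T"
proof -
  \<comment> \<open>The union starts at \<open>X m\<close>, where the pulled-back operators begin;
    monotonicity keeps it dense.\<close>
  define V where "V = (\<Union>k. X (m + k))"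
  \<comment> \<open>The least level is an arbitrary choice; by stability every level containing
    \<open>x\<close> gives the same value.\<close>
  define R where "R x = pull_back m T (LEAST k. x \<in> X (m + k)) x" for x
  have R: "R x = pull_back m T k x" if x: "x \<in> X (m + k)" for x k
  proof -
    let ?l = "LEAST k. x \<in> X (m + k)"
    have "x \<in> X (m + ?l)" using x by (rule LeastI)
    then have "pull_back m T (?l + (k - ?l)) x = R x"
      unfolding R_def by (rule pull_back_stable)
    moreover have "?l \<le> k" using x by (rule Least_le)
    ultimately show ?thesis by simp
  qed
  have common: "\<exists>k. x \<in> X (m + k) \<and> y \<in> X (m + k)" if xy: "x \<in> V" "y \<in> V" for x y
  proof -
    obtain i j where ij: "x \<in> X (m + i)" "y \<in> X (m + j)"
      using xy unfolding V_def by blast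
    then have "x \<in> X (m + (i + j))" "y \<in> X (m + (i + j))"
      using X_le[of "m + i" "m + (i + j)"] X_le[of "m + j" "m + (i + j)"] by auto
    then show ?thesis by blast
  qed
  have "X n \<subseteq> V" for n
    using X_le[of n "m + n"] by (auto simp: V_def)
  then have "(\<Union>n. X n) \<subseteq> V" by blast
  then have dense: "closure V = UNIV"
    using closure_mono[of "\<Union>n. X n" V] dense_X by auto
  have V: "subspace V"
  proof (rule subspaceI)
    show "0 \<in> V" using subspace_0[OF subspace_X] by (auto simp: V_def)
    show "x + y \<in> V" if "x \<in> V" "y \<in> V" for x y
      using common[OF that] subspace_add[OF subspace_X] by (auto simp: V_def)
    show "s c x \<in> V" if "x \<in> V" for c x
      using that subspace_scale[OF subspace_X] by (auto simp: V_def)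
  qed
  have Radd: "R (x + y) = R x + R y" if xy: "x \<in> V" "y \<in> V" for x y
  proof -
    obtain k where k: "x \<in> X (m + k)" "y \<in> X (m + k)" using common[OF xy] by blast
    then show ?thesis
      using R[OF subspace_add[OF subspace_X k]] by (simp add: R pull_back_add)
  qed
  have Rscale: "R (s c x) = s c (R x)" if x: "x \<in> V" for c x
  proof -
    obtain k where k: "x \<in> X (m + k)" using common[OF x x] by blast
    then show ?thesis
      using R[OF subspace_scale[OF subspace_X k]] by (simp add: R pull_back_scale)
  qed
  have Rnorm: "norm (R x) \<le> norm x" if x: "x \<in> V" for x
  proof -
    obtain k where k: "x \<in> X (m + k)" using common[OF x x] by blast
    then show ?thesis by (simp add: R pull_back_norm_le)
  qed
  have "\<exists>S. bounded_linear_on s s UNIV S \<and> (\<forall>x\<in>V. S x = R x) \<and> (\<forall>x. norm (S x) \<le> norm x)"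
    by (rule extend_bounded_linear_on[OF normed_space_over_axioms V dense Radd Rscale Rnorm]) auto
  then obtain S where S: "bounded_linear_on s s UNIV S" and SR: "\<And>x. x \<in> V \<Longrightarrow> S x = R x"
    and Snorm: "\<And>x. norm (S x) \<le> norm x" by blast
  have ST: "S x = T x" if "x \<in> X m" for x
  proof -
    have x: "x \<in> X (m + 0)" using that by simp
    then have "x \<in> V" unfolding V_def by blast
    then show ?thesis using SR R[OF x] by simp
  qed
  obtain z where z: "z \<in> X m" "z \<noteq> 0" using X_nontrivial by blast
  have Sball: "norm (S x) \<le> 1" if "x \<in> {x \<in> UNIV. norm x \<le> 1}" for x
    using that Snorm[of x] by simp
  have "{x \<in> UNIV. norm x \<le> 1} \<noteq> ({} :: 'a set)"
    by (auto intro!: exI[of _ 0])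
  then have "onorm_on UNIV S \<le> 1"
    unfolding onorm_on_def by (rule cSUP_least) (rule Sball)
  \<comment> \<open>As \<open>S\<close> extends \<open>T\<close>, its norm is at least one.\<close>
  moreover have "onorm_on (X m) T \<le> onorm_on UNIV S"
    unfolding onorm_on_def
  proof (rule cSUP_subset_mono)
    show "{x \<in> X m. norm x \<le> 1} \<noteq> {}" using subspace_0[OF subspace_X] by (auto intro!: exI[of _ 0])
    show "bdd_above ((\<lambda>x. norm (S x)) ` {x \<in> UNIV. norm x \<le> 1})"
      by (rule bdd_aboveI2) (rule Sball)
  qed (auto simp: ST)
  ultimately have "onorm_on UNIV S = 1" using norm_T by simp
  moreover have "S \<in> operators_on s UNIV" using S by (simp add: operators_on_def)
  moreover have "numerical_radius s UNIV S \<le> numerical_radius s (X m) T"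
  proof (rule numerical_radius_le_if_dense[OF normed_space_over_axioms dense S Snorm])
    show "0 \<le> numerical_radius s (X m) T"
      using z by (intro numerical_radius_nonneg[OF normed_space_over_axioms subspace_X T])
    fix y f assume y: "y \<in> V" and f: "norming_functional s UNIV y f"
    obtain k where k: "y \<in> X (m + k)" using y by (auto simp: V_def)
    have "norming_functional s (X (m + k)) y f"
      by (rule norming_functional_subspace[OF normed_space_over_axioms subspace_X k f])
    then show "norm (f (S y)) \<le> numerical_radius s (X m) T * norm y"
      using pull_back_numerical_range SR[OF y] R[OF k] by simp
  qed (rule z)
  ultimately show ?thesis using that by blast
qed

end

text \<open>Every competitor \<open>T\<close> on \<open>X m\<close> is matched by a competitor on
  the whole space with no larger numerical radius. The identity shows that there are competitors on
  \<open>X m\<close>, and nonnegativity bounds the infimum over the whole space from below.\<close>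

lemma numerical_index_le: "numerical_index s UNIV \<le> numerical_index s (X m)"
  unfolding numerical_index_def[of s "X m"]
proof (rule cInf_greatest)
  obtain z where z: "z \<in> X m" "norm z = 1" using X_unit by blast
  have "(\<lambda>x. x) \<in> operators_on s (X m)"
    by (auto simp: operators_on_def bounded_linear_on_def intro!: exI[of _ 1])
  moreover have "onorm_on (X m) (\<lambda>x. x) = 1"
    using z by (intro onorm_on_eq_one) auto
  ultimately show "{numerical_radius s (X m) T |T. T \<in> operators_on s (X m) \<and> onorm_on (X m) T = 1} \<noteq> {}"
    by blast
  fix t assume "t \<in> {numerical_radius s (X m) T |T. T \<in> operators_on s (X m) \<and> onorm_on (X m) T = 1}"
  then obtain T where T: "t = numerical_radius s (X m) T" "T \<in> operators_on s (X m)"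
    "onorm_on (X m) T = 1" by blast
  obtain S where S: "S \<in> operators_on s UNIV" "onorm_on UNIV S = 1" "numerical_radius s UNIV S \<le> t"
    using extension_to_limit[OF T(2,3)] T(1) by metis
  have "bdd_below {numerical_radius s UNIV T |T. T \<in> operators_on s UNIV \<and> onorm_on UNIV T = 1}"
    using z
    by (intro bdd_belowI[of _ 0])
      (auto intro!: numerical_radius_nonneg[OF normed_space_over_axioms subspace_UNIV, of _ z])
  then show "numerical_index s UNIV \<le> t"
    unfolding numerical_index_def using S by (intro cInf_lower2[of "numerical_radius s UNIV S"]) auto
qed

end

theorem proposition2p14:
  fixes s :: "'k::real_or_complex_field \<Rightarrow> 'a::banach \<Rightarrow> 'a"
    and X :: "nat \<Rightarrow> 'a set"
    and P :: "nat \<Rightarrow> 'a \<Rightarrow> 'a"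
  assumes "normed_space_over s"
    and "\<And>m. module.subspace s (X m)"
    and "\<And>m. closed (X m)"
    and "\<And>m. X m \<subseteq> X (Suc m)"
    and "closure (\<Union>m. X m) = UNIV"
    and "\<And>m. projection_onto s (X (Suc m)) (X m) (P m)"
    and "\<And>m. onorm_on (X (Suc m)) (P m) = 1"
    and "local_characterization_condition s X P"
  shows "\<forall>m. numerical_index s (X m) \<ge> numerical_index s UNIV"
proof -
  interpret projection_chain s X P
    using assms by (simp add: projection_chain_def projection_chain_axioms_def)
  show ?thesis using numerical_index_le by blast
qed

end
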